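(* Let $\delta,\eta\in\operatorname{Der}_k(A)$ be derivations, let $e\in E$ and let $x\in F$ be any element with $p(x)=e$. Then $$R_\partial(\delta\wedge\eta)(e)=p\big([\delta(M),\eta(M)](x)\big),$$ where $[\delta(M),\eta(M)]=\delta(M)\eta(M)-\eta(M)\delta(M)$ is the commutator of $n\times n$ matrices acting on $F$.
   Context: Let $k$ be a commutative unital ring, $A$ a commutative $k$-algebra, $F=A\{u_1,\dots,u_n\}$ a free $A$-module of rank $n$ with basis $u_1,\dots,u_n$, $E$ a finitely generated projective $A$-module, $p:F\to E$ a surjective $A$-linear map and $s:E\to F$ an $A$-linear section of $p$ (so $p\circ s=\mathrm{id}_E$). Put $\phi=s\circ p\in\operatorname{End}_A(F)$. Let $e_i=p(u_i)$, let $u_i^*:F\to A$ be the dual basis, let $x_i=u_i^*\circ s:E\to A$, and let $M$ be the fundamental matrix: the $n\times n$ matrix whose $(i,j)$ entry is $x_i(e_j)$, regarded as an $A$-linear map $F\to F$ in the basis $u_1,\dots,u_n$. For $\delta\in\operatorname{Der}_k(A)$ (the $k$-linear derivations $A\to A$) let $\delta(M)$ be the matrix with entries $\delta(x_i(e_j))$, and let $D_\delta:F\to F$, $D_\delta(\sum a_iu_i)=\sum\delta(a_i)u_i$. Set $\nabla(\delta)=D_\delta\circ\phi:F\to F$ and $\partial(\delta)=p\circ\nabla(\delta)\circ s:E\to E$; $\partial$ is a connection on $E$, i.e. an $A$-linear map $\operatorname{Der}_k(A)\to\operatorname{End}_k(E)$ with $\partial(\delta)(ae)=a\,\partial(\delta)(e)+\delta(a)e$.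 Its curvature is $R_\partial(\delta\wedge\eta)=[\partial(\delta),\partial(\eta)]-\partial([\delta,\eta])$. *)

theory Defs
  imports "HOL-Algebra.Algebra"
begin

text \<open>
  Rings and modules are HOL-Algebra structures with explicit carriers, so the zero ring is not
  excluded. A \<open>k\<close>-algebra \<open>A\<close> is a module record over \<open>k\<close> whose ring part is at
  the same time the scalar ring of the \<open>A\<close>-modules \<open>E\<close> and \<open>F\<close>. Maps are total HOL functions
  whose values outside the carrier are irrelevant.
\<close>

definition linear_maps ::
  "('r, 'q) ring_scheme \<Rightarrow> ('r, 'm, 'c) module_scheme \<Rightarrow> ('r, 'n, 'd) module_scheme \<Rightarrow> ('m \<Rightarrow> 'n) set"
  where "linear_maps R M N =
    {f \<in> carrier M \<rightarrow> carrier N.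
       (\<forall>x\<in>carrier M. \<forall>y\<in>carrier M. f (x \<oplus>\<^bsub>M\<^esub> y) = f x \<oplus>\<^bsub>N\<^esub> f y) \<and>
       (\<forall>r\<in>carrier R. \<forall>x\<in>carrier M. f (r \<odot>\<^bsub>M\<^esub> x) = r \<odot>\<^bsub>N\<^esub> f x)}"

definition derivations :: "('k, 'q) ring_scheme \<Rightarrow> ('k, 'a, 'b) module_scheme \<Rightarrow> ('a \<Rightarrow> 'a) set"
  where "derivations k A =
    {d \<in> linear_maps k A A. \<forall>a\<in>carrier A. \<forall>b\<in>carrier A.
       d (a \<otimes>\<^bsub>A\<^esub> b) = a \<otimes>\<^bsub>A\<^esub> d b \<oplus>\<^bsub>A\<^esub> d a \<otimes>\<^bsub>A\<^esub> b}"

definition der_bracket :: "('a, 'b) ring_scheme \<Rightarrow> ('a \<Rightarrow> 'a) \<Rightarrow> ('a \<Rightarrow> 'a) \<Rightarrow> 'a \<Rightarrow> 'a"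
  where "der_bracket A \<delta> \<eta> = (\<lambda>a. \<delta> (\<eta> a) \<ominus>\<^bsub>A\<^esub> \<eta> (\<delta> a))"

text \<open>
  A basis is an indexed family, and uniqueness of coordinates is required of the family (over the
  zero ring a basis may repeat elements). Coefficient families are extensional so that they are
  determined by their values on \<open>{1..n}\<close>.
\<close>

definition free_basis ::
  "('a, 'b) ring_scheme \<Rightarrow> ('a, 'f, 'd) module_scheme \<Rightarrow> nat \<Rightarrow> (nat \<Rightarrow> 'f) \<Rightarrow> bool"
  where "free_basis A F n u \<longleftrightarrow>
    module A F \<and> u \<in> {1..n} \<rightarrow> carrier F \<and>
    (\<forall>x\<in>carrier F. \<exists>!a. a \<in> {1..n} \<rightarrow>\<^sub>E carrier A \<and> x = (\<Oplus>\<^bsub>F\<^esub>i\<in>{1..n}. a i \<odot>\<^bsub>F\<^esub> u i))"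

definition dual_basis ::
  "('a, 'b) ring_scheme \<Rightarrow> ('a, 'f, 'd) module_scheme \<Rightarrow> nat \<Rightarrow> (nat \<Rightarrow> 'f) \<Rightarrow> nat \<Rightarrow> 'f \<Rightarrow> 'a"
  where "dual_basis A F n u i x =
    (THE a. a \<in> {1..n} \<rightarrow>\<^sub>E carrier A \<and> x = (\<Oplus>\<^bsub>F\<^esub>j\<in>{1..n}. a j \<odot>\<^bsub>F\<^esub> u j)) i"

text \<open>
  Finitely generated projective means being a direct summand (a retract) of a free module of finite
  rank. The type \<^typ>\<open>nat \<Rightarrow> 'a\<close> is no restriction on the free module, as it
  accommodates \<open>A\<^sup>m\<close> for every \<open>m\<close>.
\<close>

definition fg_projective :: "('a, 'b) ring_scheme \<Rightarrow> ('a, 'e, 'd) module_scheme \<Rightarrow> bool"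
  where "fg_projective A E \<longleftrightarrow>
    module A E \<and>
    (\<exists>m (G :: ('a, nat \<Rightarrow> 'a) module) v. free_basis A G m v \<and>
       (\<exists>\<pi>\<in>linear_maps A G E. \<exists>\<sigma>\<in>linear_maps A E G. \<forall>e\<in>carrier E. \<pi> (\<sigma> e) = e))"

text \<open>
  An \<open>n \<times> n\<close> matrix is a function \<open>nat \<Rightarrow> nat \<Rightarrow> 'a\<close> used on \<open>{1..n} \<times> {1..n}\<close> only.
\<close>

definition mat_commutator ::
  "('a, 'b) ring_scheme \<Rightarrow> nat \<Rightarrow> (nat \<Rightarrow> nat \<Rightarrow> 'a) \<Rightarrow> (nat \<Rightarrow> nat \<Rightarrow> 'a) \<Rightarrow> nat \<Rightarrow> nat \<Rightarrow> 'a"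
  where "mat_commutator A n P Q = (\<lambda>i j.
    (\<Oplus>\<^bsub>A\<^esub>l\<in>{1..n}. P i l \<otimes>\<^bsub>A\<^esub> Q l j) \<ominus>\<^bsub>A\<^esub> (\<Oplus>\<^bsub>A\<^esub>l\<in>{1..n}. Q i l \<otimes>\<^bsub>A\<^esub> P l j))"

definition mat_apply ::
  "('a, 'b) ring_scheme \<Rightarrow> ('a, 'f, 'd) module_scheme \<Rightarrow> nat \<Rightarrow> (nat \<Rightarrow> 'f) \<Rightarrow>
   (nat \<Rightarrow> nat \<Rightarrow> 'a) \<Rightarrow> 'f \<Rightarrow> 'f"
  where "mat_apply A F n u P x =
    (\<Oplus>\<^bsub>F\<^esub>i\<in>{1..n}. (\<Oplus>\<^bsub>A\<^esub>j\<in>{1..n}. P i j \<otimes>\<^bsub>A\<^esub> dual_basis A F n u j x) \<odot>\<^bsub>F\<^esub> u i)"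

definition fundamental_matrix ::
  "('a, 'b) ring_scheme \<Rightarrow> ('a, 'f, 'd) module_scheme \<Rightarrow> nat \<Rightarrow> (nat \<Rightarrow> 'f) \<Rightarrow>
   ('f \<Rightarrow> 'e) \<Rightarrow> ('e \<Rightarrow> 'f) \<Rightarrow> nat \<Rightarrow> nat \<Rightarrow> 'a"
  where "fundamental_matrix A F n u p s = (\<lambda>i j. dual_basis A F n u i (s (p (u j))))"

definition mat_der :: "('a \<Rightarrow> 'a) \<Rightarrow> (nat \<Rightarrow> nat \<Rightarrow> 'a) \<Rightarrow> nat \<Rightarrow> nat \<Rightarrow> 'a"
  where "mat_der \<delta> P = (\<lambda>i j. \<delta> (P i j))"

definition coord_der ::
  "('a, 'b) ring_scheme \<Rightarrow> ('a, 'f, 'd) module_scheme \<Rightarrow> nat \<Rightarrow> (nat \<Rightarrow> 'f) \<Rightarrow>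
   ('a \<Rightarrow> 'a) \<Rightarrow> 'f \<Rightarrow> 'f"
  where "coord_der A F n u \<delta> x = (\<Oplus>\<^bsub>F\<^esub>i\<in>{1..n}. \<delta> (dual_basis A F n u i x) \<odot>\<^bsub>F\<^esub> u i)"

definition nabla ::
  "('a, 'b) ring_scheme \<Rightarrow> ('a, 'f, 'd) module_scheme \<Rightarrow> nat \<Rightarrow> (nat \<Rightarrow> 'f) \<Rightarrow>
   ('f \<Rightarrow> 'e) \<Rightarrow> ('e \<Rightarrow> 'f) \<Rightarrow> ('a \<Rightarrow> 'a) \<Rightarrow> 'f \<Rightarrow> 'f"
  where "nabla A F n u p s \<delta> = coord_der A F n u \<delta> \<circ> (s \<circ> p)"

definition induced_connection ::
  "('a, 'b) ring_scheme \<Rightarrow> ('a, 'f, 'd) module_scheme \<Rightarrow> nat \<Rightarrow> (nat \<Rightarrow> 'f) \<Rightarrow>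
   ('f \<Rightarrow> 'e) \<Rightarrow> ('e \<Rightarrow> 'f) \<Rightarrow> ('a \<Rightarrow> 'a) \<Rightarrow> 'e \<Rightarrow> 'e"
  where "induced_connection A F n u p s \<delta> = p \<circ> nabla A F n u p s \<delta> \<circ> s"

text \<open>
  The value on the decomposable element \<open>\<delta> \<and> \<eta>\<close> is given as a function of the pair.
\<close>

definition curvature ::
  "('a, 'b) ring_scheme \<Rightarrow> ('a, 'e, 'd) module_scheme \<Rightarrow> (('a \<Rightarrow> 'a) \<Rightarrow> 'e \<Rightarrow> 'e) \<Rightarrow>
   ('a \<Rightarrow> 'a) \<Rightarrow> ('a \<Rightarrow> 'a) \<Rightarrow> 'e \<Rightarrow> 'e"
  where "curvature A E C \<delta> \<eta> = (\<lambda>e.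
    (C \<delta> (C \<eta> e) \<ominus>\<^bsub>E\<^esub> C \<eta> (C \<delta> e)) \<ominus>\<^bsub>E\<^esub> C (der_bracket A \<delta> \<eta>) e)"

end

theory Submission
  imports Defs
begin

text \<open>
  Write \<open>\<phi> = s \<circ> p\<close>, an idempotent endomorphism of \<open>F\<close> whose matrix is \<open>M\<close>, and write \<open>D\<^sub>\<delta>\<close> for the
  coordinatewise derivation and \<open>M\<^sub>\<delta>\<close> for the endomorphism of \<open>F\<close> with matrix \<open>\<delta>(M)\<close>. Everything
  rests on the Leibniz rule for the product of a matrix and a vector (\<open>coord_der_linear\<close>), which
  for \<open>\<phi>\<close> reads \<open>D\<^sub>\<delta> \<phi> = M\<^sub>\<delta> + \<phi> D\<^sub>\<delta>\<close>.

  Composing with \<open>p\<close> gives \<open>p D\<^sub>\<delta> \<phi> = p M\<^sub>\<delta> + p D\<^sub>\<delta>\<close>, because \<open>p \<phi> = p\<close>. Composing this once more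
  with \<open>\<phi>\<close>, on the right, and using \<open>\<phi> \<phi> = \<phi>\<close> gives \<open>p M\<^sub>\<delta> \<phi> = 0\<close>. Hence
  (\<open>project_composite\<close>)

  \<^item> \<open>p D\<^sub>\<delta> \<phi> D\<^sub>\<eta> \<phi> = p M\<^sub>\<delta> (D\<^sub>\<eta> \<phi>) + p D\<^sub>\<delta> D\<^sub>\<eta> \<phi>\<close>
  \<^item> \<open>p M\<^sub>\<delta> (D\<^sub>\<eta> \<phi>) = p M\<^sub>\<delta> M\<^sub>\<eta> + p M\<^sub>\<delta> \<phi> D\<^sub>\<eta> = p M\<^sub>\<delta> M\<^sub>\<eta>\<close>

  At \<open>x\<close>, the left side of the first line is \<open>\<partial>(\<delta>)(\<partial>(\<eta>)(e))\<close>, because \<open>p s = 1\<close> and \<open>p x = e\<close>. After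
  antisymmetrising, the terms \<open>p D\<^sub>\<delta> D\<^sub>\<eta> \<phi> - p D\<^sub>\<eta> D\<^sub>\<delta> \<phi>\<close> cancel against \<open>\<partial>([\<delta>, \<eta>])\<close>, since the
  coordinatewise action respects brackets (\<open>coord_der_bracket\<close>), and \<open>p (M\<^sub>\<delta> M\<^sub>\<eta> - M\<^sub>\<eta> M\<^sub>\<delta>)\<close> remains.
\<close>

section \<open>Additive maps and finite sums\<close>

lemma linear_mapsD:
  assumes "f \<in> linear_maps R M N"
  shows linear_maps_closed: "x \<in> carrier M \<Longrightarrow> f x \<in> carrier N"
    and linear_maps_add: "x \<in> carrier M \<Longrightarrow> y \<in> carrier M \<Longrightarrow> f (x \<oplus>\<^bsub>M\<^esub> y) = f x \<oplus>\<^bsub>N\<^esub> f y"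
    and linear_maps_smult: "r \<in> carrier R \<Longrightarrow> x \<in> carrier M \<Longrightarrow> f (r \<odot>\<^bsub>M\<^esub> x) = r \<odot>\<^bsub>N\<^esub> f x"
  using assms unfolding linear_maps_def by auto

lemma derivationsD:
  assumes "\<delta> \<in> derivations k A"
  shows derivations_linear: "\<delta> \<in> linear_maps k A A"
    and derivations_leibniz: "a \<in> carrier A \<Longrightarrow> b \<in> carrier A \<Longrightarrow>
      \<delta> (a \<otimes>\<^bsub>A\<^esub> b) = a \<otimes>\<^bsub>A\<^esub> \<delta> b \<oplus>\<^bsub>A\<^esub> \<delta> a \<otimes>\<^bsub>A\<^esub> b"
  using assms unfolding derivations_def by auto

lemma abelian_group_hom_of_add:
  assumes "abelian_group G" "abelian_group H"
    and "\<And>x. x \<in> carrier G \<Longrightarrow> h x \<in> carrier H"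
    and "\<And>x y. x \<in> carrier G \<Longrightarrow> y \<in> carrier G \<Longrightarrow> h (x \<oplus>\<^bsub>G\<^esub> y) = h x \<oplus>\<^bsub>H\<^esub> h y"
  shows "abelian_group_hom G H h"
  using assms
  by (auto intro!: abelian_group_homI group_hom.intro group_hom_axioms.intro
      abelian_group.a_group homI)

lemma abelian_group_hom_of_linear:
  assumes "abelian_group M" "abelian_group N" "f \<in> linear_maps R M N"
  shows "abelian_group_hom M N f"
  using assms by (blast intro: abelian_group_hom_of_add linear_maps_closed linear_maps_add)

lemma (in abelian_group_hom) hom_minus:
  assumes "x \<in> carrier G" "y \<in> carrier G"
  shows "h (x \<ominus>\<^bsub>G\<^esub> y) = h x \<ominus>\<^bsub>H\<^esub> h y"
  using assms by (simp add: G.minus_eq H.minus_eq)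

lemma (in abelian_group_hom) hom_finsum:
  assumes "finite I" "\<And>i. i \<in> I \<Longrightarrow> g i \<in> carrier G"
  shows "h (\<Oplus>\<^bsub>G\<^esub>i\<in>I. g i) = (\<Oplus>\<^bsub>H\<^esub>i\<in>I. h (g i))"
  using assms by (induction I) (simp_all add: Pi_def)

lemma (in abelian_group) finsum_minus:
  assumes "finite I" "\<And>i. i \<in> I \<Longrightarrow> f i \<in> carrier G" "\<And>i. i \<in> I \<Longrightarrow> g i \<in> carrier G"
  shows "(\<Oplus>i\<in>I. f i \<ominus> g i) = (\<Oplus>i\<in>I. f i) \<ominus> (\<Oplus>i\<in>I. g i)"
proof -
  have minus_zero: "\<ominus> \<zero> = \<zero>"
    by (rule minus_equality) simp_all
  show ?thesis
    using assms by (induction I) (simp_all add: Pi_def minus_eq minus_add a_ac minus_zero)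
qed

lemma (in abelian_group) sum_difference_cancel:
  assumes "a \<in> carrier G" "b \<in> carrier G" "c \<in> carrier G" "d \<in> carrier G"
  shows "((a \<oplus> c) \<ominus> (b \<oplus> d)) \<ominus> (c \<ominus> d) = a \<ominus> b"
proof -
  have "((a \<oplus> c) \<ominus> (b \<oplus> d)) \<ominus> (c \<ominus> d) = (a \<ominus> b) \<oplus> ((c \<oplus> \<ominus> c) \<oplus> (d \<oplus> \<ominus> d))"
    using assms by (simp only: minus_eq minus_add minus_minus a_closed a_inv_closed a_ac)
  also have "\<dots> = a \<ominus> b"
    using assms by (simp add: r_neg)
  finally show ?thesis .
qed

lemma (in abelian_monoid) finsum_swap:
  assumes "finite I" "\<And>i j. i \<in> I \<Longrightarrow> j \<in> J \<Longrightarrow> f i j \<in> carrier G"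
  shows "(\<Oplus>i\<in>I. \<Oplus>j\<in>J. f i j) = (\<Oplus>j\<in>J. \<Oplus>i\<in>I. f i j)"
  using assms
proof (induction I)
  case empty
  then show ?case by simp
next
  case (insert i I)
  have "(\<Oplus>j\<in>J. \<Oplus>i\<in>insert i I. f i j) = (\<Oplus>j\<in>J. f i j \<oplus> (\<Oplus>i\<in>I. f i j))"
    using insert by (intro finsum_cong') (auto intro!: finsum_insert finsum_closed)
  also have "\<dots> = (\<Oplus>j\<in>J. f i j) \<oplus> (\<Oplus>j\<in>J. \<Oplus>i\<in>I. f i j)"
    using insert by (intro finsum_addf) (auto intro!: finsum_closed)
  also have "\<dots> = (\<Oplus>i\<in>insert i I. \<Oplus>j\<in>J. f i j)"
    using insert by (subst finsum_insert) (auto intro!: finsum_closed)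
  finally show ?case by simp
qed

section \<open>Coordinates in a free module\<close>

text \<open>
  The index set \<open>{1..n}\<close> serves only as a finite set; membership in it is kept folded so that facts
  about indices match syntactically.
\<close>

declare One_nat_def [simp del] atLeastAtMost_iff [simp del]

locale framed_module = module A F for A (structure) and F (structure) +
  fixes n :: nat and u :: "nat \<Rightarrow> 'c"
  assumes basis: "free_basis A F n u"
begin

abbreviation coord :: "nat \<Rightarrow> 'c \<Rightarrow> 'a"
  where "coord \<equiv> dual_basis A F n u"

abbreviation lincomb :: "(nat \<Rightarrow> 'a) \<Rightarrow> 'c"
  where "lincomb a \<equiv> \<Oplus>\<^bsub>F\<^esub>i\<in>{1..n}. a i \<odot>\<^bsub>F\<^esub> u i"

lemma basis_closed [simp]: "i \<in> {1..n} \<Longrightarrow> u i \<in> carrier F"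
  using basis unfolding free_basis_def by auto

lemma lincomb_closed [simp]:
  "(\<And>i. i \<in> {1..n} \<Longrightarrow> a i \<in> carrier A) \<Longrightarrow> lincomb a \<in> carrier F"
  using basis_closed by (intro M.finsum_closed) auto

lemma lincomb_cong:
  assumes "\<And>i. i \<in> {1..n} \<Longrightarrow> b i \<in> carrier A" "\<And>i. i \<in> {1..n} \<Longrightarrow> a i = b i"
  shows "lincomb a = lincomb b"
  using assms basis_closed by (intro M.finsum_cong') auto

lemma coord_family:
  assumes "x \<in> carrier F"
  shows "(\<lambda>i. coord i x) \<in> {1..n} \<rightarrow>\<^sub>E carrier A \<and> x = lincomb (\<lambda>i. coord i x)"
proof -
  have "\<exists>!a. a \<in> {1..n} \<rightarrow>\<^sub>E carrier A \<and> x = lincomb a"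
    using basis assms unfolding free_basis_def by blast
  from theI'[OF this] show ?thesis
    unfolding dual_basis_def by simp
qed

lemma coord_closed [simp]: "x \<in> carrier F \<Longrightarrow> i \<in> {1..n} \<Longrightarrow> coord i x \<in> carrier A"
  using coord_family by (auto dest!: PiE_mem)

lemma lincomb_coord: "x \<in> carrier F \<Longrightarrow> lincomb (\<lambda>i. coord i x) = x"
  using coord_family by auto

lemma coord_lincomb:
  assumes a: "\<And>i. i \<in> {1..n} \<Longrightarrow> a i \<in> carrier A" and i: "i \<in> {1..n}"
  shows "coord i (lincomb a) = a i"
proof -
  let ?b = "restrict a {1..n}"
  have x: "lincomb a \<in> carrier F"
    using a by simp
  have "\<exists>!b. b \<in> {1..n} \<rightarrow>\<^sub>E carrier A \<and> lincomb a = lincomb b"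
    using basis x unfolding free_basis_def by blast
  moreover have "?b \<in> {1..n} \<rightarrow>\<^sub>E carrier A \<and> lincomb a = lincomb ?b"
    using a by (auto intro!: lincomb_cong)
  ultimately have "(\<lambda>i. coord i (lincomb a)) = ?b"
    using coord_family[OF x] by blast
  then show ?thesis
    using i by (metis restrict_apply')
qed

lemma coord_eqI:
  assumes "x \<in> carrier F" "y \<in> carrier F" "\<And>i. i \<in> {1..n} \<Longrightarrow> coord i x = coord i y"
  shows "x = y"
proof -
  have "lincomb (\<lambda>i. coord i x) = lincomb (\<lambda>i. coord i y)"
    using assms by (intro lincomb_cong) auto
  then show ?thesis
    using assms by (simp add: lincomb_coord)
qed

lemma coord_add:
  assumes "x \<in> carrier F" "y \<in> carrier F" "i \<in> {1..n}"
  shows "coord i (x \<oplus>\<^bsub>F\<^esub> y) = coord i x \<oplus> coord i y"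
proof -
  have "x \<oplus>\<^bsub>F\<^esub> y = lincomb (\<lambda>i. coord i x) \<oplus>\<^bsub>F\<^esub> lincomb (\<lambda>i. coord i y)"
    using assms by (simp add: lincomb_coord)
  also have "\<dots> = (\<Oplus>\<^bsub>F\<^esub>i\<in>{1..n}. coord i x \<odot>\<^bsub>F\<^esub> u i \<oplus>\<^bsub>F\<^esub> coord i y \<odot>\<^bsub>F\<^esub> u i)"
    using assms basis_closed by (intro M.finsum_addf[symmetric]) auto
  also have "\<dots> = lincomb (\<lambda>i. coord i x \<oplus> coord i y)"
    using assms basis_closed by (intro M.finsum_cong') (auto simp: smult_l_distr)
  finally show ?thesis
    using assms by (simp add: coord_lincomb)
qed

lemma coord_smult:
  assumes "a \<in> carrier A" "x \<in> carrier F" "i \<in> {1..n}"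
  shows "coord i (a \<odot>\<^bsub>F\<^esub> x) = a \<otimes> coord i x"
proof -
  have "a \<odot>\<^bsub>F\<^esub> x = a \<odot>\<^bsub>F\<^esub> lincomb (\<lambda>i. coord i x)"
    using assms by (simp add: lincomb_coord)
  also have "\<dots> = (\<Oplus>\<^bsub>F\<^esub>i\<in>{1..n}. a \<odot>\<^bsub>F\<^esub> (coord i x \<odot>\<^bsub>F\<^esub> u i))"
    using assms basis_closed by (intro finsum_smult_ldistr) auto
  also have "\<dots> = lincomb (\<lambda>i. a \<otimes> coord i x)"
    using assms basis_closed by (intro M.finsum_cong') (auto simp: smult_assoc1)
  finally show ?thesis
    using assms by (simp add: coord_lincomb)
qed

lemma coord_hom: "i \<in> {1..n} \<Longrightarrow> abelian_group_hom F A (coord i)"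
  by (intro abelian_group_hom_of_add coord_closed coord_add
      M.abelian_group_axioms R.abelian_group_axioms)

lemma coord_minus:
  "\<lbrakk>x \<in> carrier F; y \<in> carrier F; i \<in> {1..n}\<rbrakk> \<Longrightarrow> coord i (x \<ominus>\<^bsub>F\<^esub> y) = coord i x \<ominus> coord i y"
  by (rule abelian_group_hom.hom_minus[OF coord_hom])

section \<open>Matrices and derivations acting on coordinates\<close>

lemma mat_apply_closed:
  assumes "\<And>i j. i \<in> {1..n} \<Longrightarrow> j \<in> {1..n} \<Longrightarrow> P i j \<in> carrier A" "x \<in> carrier F"
  shows "mat_apply A F n u P x \<in> carrier F"
  unfolding mat_apply_def using assms by (auto intro!: lincomb_closed R.finsum_closed)

lemma coord_mat_apply:
  assumes "\<And>i j. i \<in> {1..n} \<Longrightarrow> j \<in> {1..n} \<Longrightarrow> P i j \<in> carrier A" "x \<in> carrier F" "i \<in> {1..n}"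
  shows "coord i (mat_apply A F n u P x) = (\<Oplus>j\<in>{1..n}. P i j \<otimes> coord j x)"
  unfolding mat_apply_def using assms by (intro coord_lincomb) (auto intro!: R.finsum_closed)

lemma mat_apply_hom:
  assumes P: "\<And>i j. i \<in> {1..n} \<Longrightarrow> j \<in> {1..n} \<Longrightarrow> P i j \<in> carrier A"
  shows "abelian_group_hom F F (mat_apply A F n u P)"
proof (intro abelian_group_hom_of_add M.abelian_group_axioms)
  show "mat_apply A F n u P x \<in> carrier F" if "x \<in> carrier F" for x
    using P that by (rule mat_apply_closed)
next
  fix x y assume xy: "x \<in> carrier F" "y \<in> carrier F"
  show "mat_apply A F n u P (x \<oplus>\<^bsub>F\<^esub> y) = mat_apply A F n u P x \<oplus>\<^bsub>F\<^esub> mat_apply A F n u P y"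
  proof (rule coord_eqI)
    fix i assume i: "i \<in> {1..n}"
    have "(\<Oplus>j\<in>{1..n}. P i j \<otimes> coord j (x \<oplus>\<^bsub>F\<^esub> y))
        = (\<Oplus>j\<in>{1..n}. P i j \<otimes> coord j x \<oplus> P i j \<otimes> coord j y)"
      using P xy i by (intro R.finsum_cong') (auto simp: coord_add R.r_distr)
    also have "\<dots> = (\<Oplus>j\<in>{1..n}. P i j \<otimes> coord j x) \<oplus> (\<Oplus>j\<in>{1..n}. P i j \<otimes> coord j y)"
      using P xy i by (intro R.finsum_addf) auto
    finally show "coord i (mat_apply A F n u P (x \<oplus>\<^bsub>F\<^esub> y))
        = coord i (mat_apply A F n u P x \<oplus>\<^bsub>F\<^esub> mat_apply A F n u P y)"
      using P xy i by (simp add: coord_mat_apply coord_add mat_apply_closed)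
  qed (use P xy in \<open>auto intro!: mat_apply_closed\<close>)
qed

lemma coord_mat_apply_mat_apply:
  assumes P: "\<And>i j. i \<in> {1..n} \<Longrightarrow> j \<in> {1..n} \<Longrightarrow> P i j \<in> carrier A"
    and Q: "\<And>i j. i \<in> {1..n} \<Longrightarrow> j \<in> {1..n} \<Longrightarrow> Q i j \<in> carrier A"
    and x: "x \<in> carrier F" and i: "i \<in> {1..n}"
  shows "coord i (mat_apply A F n u P (mat_apply A F n u Q x))
    = (\<Oplus>j\<in>{1..n}. (\<Oplus>l\<in>{1..n}. P i l \<otimes> Q l j) \<otimes> coord j x)"
proof -
  have "coord i (mat_apply A F n u P (mat_apply A F n u Q x))
      = (\<Oplus>l\<in>{1..n}. P i l \<otimes> coord l (mat_apply A F n u Q x))"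
    using P Q x i by (intro coord_mat_apply mat_apply_closed) auto
  also have "\<dots> = (\<Oplus>l\<in>{1..n}. \<Oplus>j\<in>{1..n}. P i l \<otimes> Q l j \<otimes> coord j x)"
  proof (intro R.finsum_cong')
    fix l assume l: "l \<in> {1..n}"
    have "P i l \<otimes> coord l (mat_apply A F n u Q x) = P i l \<otimes> (\<Oplus>j\<in>{1..n}. Q l j \<otimes> coord j x)"
      using Q x l by (simp add: coord_mat_apply)
    also have "\<dots> = (\<Oplus>j\<in>{1..n}. P i l \<otimes> (Q l j \<otimes> coord j x))"
      using P Q x i l by (intro R.finsum_rdistr) auto
    also have "\<dots> = (\<Oplus>j\<in>{1..n}. P i l \<otimes> Q l j \<otimes> coord j x)"
      using P Q x i l by (intro R.finsum_cong') (auto simp: R.m_assoc)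
    finally show "P i l \<otimes> coord l (mat_apply A F n u Q x)
        = (\<Oplus>j\<in>{1..n}. P i l \<otimes> Q l j \<otimes> coord j x)" .
  qed (use P Q x i in \<open>auto intro!: R.finsum_closed\<close>)
  also have "\<dots> = (\<Oplus>j\<in>{1..n}. \<Oplus>l\<in>{1..n}. P i l \<otimes> Q l j \<otimes> coord j x)"
    using P Q x i by (intro R.finsum_swap) auto
  also have "\<dots> = (\<Oplus>j\<in>{1..n}. (\<Oplus>l\<in>{1..n}. P i l \<otimes> Q l j) \<otimes> coord j x)"
    using P Q x i
    by (intro R.finsum_cong' R.finsum_ldistr[symmetric]) (auto intro!: R.finsum_closed R.m_closed)
  finally show ?thesis .
qed

lemma mat_commutator_apply:
  assumes P: "\<And>i j. i \<in> {1..n} \<Longrightarrow> j \<in> {1..n} \<Longrightarrow> P i j \<in> carrier A"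
    and Q: "\<And>i j. i \<in> {1..n} \<Longrightarrow> j \<in> {1..n} \<Longrightarrow> Q i j \<in> carrier A"
    and x: "x \<in> carrier F"
  shows "mat_apply A F n u (mat_commutator A n P Q) x
    = mat_apply A F n u P (mat_apply A F n u Q x) \<ominus>\<^bsub>F\<^esub> mat_apply A F n u Q (mat_apply A F n u P x)"
proof (rule coord_eqI)
  have PQ: "(\<Oplus>l\<in>{1..n}. P i l \<otimes> Q l j) \<in> carrier A"
    and QP: "(\<Oplus>l\<in>{1..n}. Q i l \<otimes> P l j) \<in> carrier A"
    if "i \<in> {1..n}" "j \<in> {1..n}" for i j
    using P Q that by (auto intro!: R.finsum_closed)
  have C: "mat_commutator A n P Q i j \<in> carrier A" if "i \<in> {1..n}" "j \<in> {1..n}" for i j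
    using PQ QP that unfolding mat_commutator_def by (intro R.minus_closed)
  show "mat_apply A F n u (mat_commutator A n P Q) x \<in> carrier F"
    using C x by (intro mat_apply_closed)
  show "mat_apply A F n u P (mat_apply A F n u Q x)
      \<ominus>\<^bsub>F\<^esub> mat_apply A F n u Q (mat_apply A F n u P x) \<in> carrier F"
    using P Q x by (intro M.minus_closed mat_apply_closed) auto
  fix i assume i: "i \<in> {1..n}"
  have "coord i (mat_apply A F n u (mat_commutator A n P Q) x)
      = (\<Oplus>j\<in>{1..n}. mat_commutator A n P Q i j \<otimes> coord j x)"
    using C x i by (intro coord_mat_apply)
  also have "\<dots> = (\<Oplus>j\<in>{1..n}. (\<Oplus>l\<in>{1..n}. P i l \<otimes> Q l j) \<otimes> coord j x
      \<ominus> (\<Oplus>l\<in>{1..n}. Q i l \<otimes> P l j) \<otimes> coord j x)"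
    unfolding mat_commutator_def
    using PQ QP x i
    by (intro R.finsum_cong') (auto simp: R.minus_eq R.l_distr R.l_minus)
  also have "\<dots> = (\<Oplus>j\<in>{1..n}. (\<Oplus>l\<in>{1..n}. P i l \<otimes> Q l j) \<otimes> coord j x)
      \<ominus> (\<Oplus>j\<in>{1..n}. (\<Oplus>l\<in>{1..n}. Q i l \<otimes> P l j) \<otimes> coord j x)"
    using PQ QP x i by (intro R.finsum_minus) auto
  also have "\<dots> = coord i (mat_apply A F n u P (mat_apply A F n u Q x)
      \<ominus>\<^bsub>F\<^esub> mat_apply A F n u Q (mat_apply A F n u P x))"
    using P Q x i by (simp add: coord_minus coord_mat_apply_mat_apply mat_apply_closed)
  finally show "coord i (mat_apply A F n u (mat_commutator A n P Q) x)
      = coord i (mat_apply A F n u P (mat_apply A F n u Q x)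
        \<ominus>\<^bsub>F\<^esub> mat_apply A F n u Q (mat_apply A F n u P x))" .
qed

lemma coord_der_closed:
  assumes "\<And>a. a \<in> carrier A \<Longrightarrow> \<delta> a \<in> carrier A" "x \<in> carrier F"
  shows "coord_der A F n u \<delta> x \<in> carrier F"
  unfolding coord_der_def using assms by (intro lincomb_closed) auto

lemma coord_coord_der:
  assumes "\<And>a. a \<in> carrier A \<Longrightarrow> \<delta> a \<in> carrier A" "x \<in> carrier F" "i \<in> {1..n}"
  shows "coord i (coord_der A F n u \<delta> x) = \<delta> (coord i x)"
  unfolding coord_der_def using assms by (intro coord_lincomb) auto

lemma coord_der_bracket:
  assumes \<delta>: "\<And>a. a \<in> carrier A \<Longrightarrow> \<delta> a \<in> carrier A"
    and \<eta>: "\<And>a. a \<in> carrier A \<Longrightarrow> \<eta> a \<in> carrier A"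
    and x: "x \<in> carrier F"
  shows "coord_der A F n u (der_bracket A \<delta> \<eta>) x
    = coord_der A F n u \<delta> (coord_der A F n u \<eta> x) \<ominus>\<^bsub>F\<^esub> coord_der A F n u \<eta> (coord_der A F n u \<delta> x)"
proof (rule coord_eqI)
  have b: "der_bracket A \<delta> \<eta> a \<in> carrier A" if "a \<in> carrier A" for a
    using \<delta> \<eta> that unfolding der_bracket_def by simp
  show "coord_der A F n u (der_bracket A \<delta> \<eta>) x \<in> carrier F"
    using b x by (rule coord_der_closed)
  show "coord_der A F n u \<delta> (coord_der A F n u \<eta> x)
      \<ominus>\<^bsub>F\<^esub> coord_der A F n u \<eta> (coord_der A F n u \<delta> x) \<in> carrier F"
    using \<delta> \<eta> x by (intro M.minus_closed coord_der_closed)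
  fix i assume "i \<in> {1..n}"
  then show "coord i (coord_der A F n u (der_bracket A \<delta> \<eta>) x)
      = coord i (coord_der A F n u \<delta> (coord_der A F n u \<eta> x)
        \<ominus>\<^bsub>F\<^esub> coord_der A F n u \<eta> (coord_der A F n u \<delta> x))"
    using b \<delta> \<eta> x
    by (simp add: coord_coord_der coord_minus coord_der_closed) (simp add: der_bracket_def)
qed

lemma coord_linear:
  assumes f: "f \<in> linear_maps A F F" and x: "x \<in> carrier F" and i: "i \<in> {1..n}"
  shows "coord i (f x) = (\<Oplus>j\<in>{1..n}. coord i (f (u j)) \<otimes> coord j x)"
proof -
  have hom: "abelian_group_hom F F f"
    using f by (intro abelian_group_hom_of_linear M.abelian_group_axioms)
  have "f x = f (lincomb (\<lambda>j. coord j x))"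
    using x by (simp add: lincomb_coord)
  also have "\<dots> = (\<Oplus>\<^bsub>F\<^esub>j\<in>{1..n}. f (coord j x \<odot>\<^bsub>F\<^esub> u j))"
    using x by (intro abelian_group_hom.hom_finsum[OF hom]) auto
  also have "\<dots> = (\<Oplus>\<^bsub>F\<^esub>j\<in>{1..n}. coord j x \<odot>\<^bsub>F\<^esub> f (u j))"
    using x by (intro M.finsum_cong') (auto simp: linear_maps_smult[OF f] linear_maps_closed[OF f])
  finally have "coord i (f x) = coord i (\<Oplus>\<^bsub>F\<^esub>j\<in>{1..n}. coord j x \<odot>\<^bsub>F\<^esub> f (u j))"
    by simp
  also have "\<dots> = (\<Oplus>j\<in>{1..n}. coord i (coord j x \<odot>\<^bsub>F\<^esub> f (u j)))"
    using x i
    by (intro abelian_group_hom.hom_finsum[OF coord_hom]) (auto simp: linear_maps_closed[OF f])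
  also have "\<dots> = (\<Oplus>j\<in>{1..n}. coord i (f (u j)) \<otimes> coord j x)"
    using x i
    by (intro R.finsum_cong') (auto simp: coord_smult linear_maps_closed[OF f] R.m_comm)
  finally show ?thesis .
qed

text \<open>
  Since \<open>f\<close> acts on coordinates by its matrix, this is the product rule applied to each term of
  each row of that matrix times the coordinate vector.
\<close>

lemma coord_der_linear:
  assumes f: "f \<in> linear_maps A F F" and hom: "abelian_group_hom A A \<delta>"
    and product_rule: "\<And>a b. a \<in> carrier A \<Longrightarrow> b \<in> carrier A \<Longrightarrow> \<delta> (a \<otimes> b) = a \<otimes> \<delta> b \<oplus> \<delta> a \<otimes> b"
    and x: "x \<in> carrier F"
  shows "coord_der A F n u \<delta> (f x)
    = mat_apply A F n u (mat_der \<delta> (\<lambda>i j. coord i (f (u j)))) x \<oplus>\<^bsub>F\<^esub> f (coord_der A F n u \<delta> x)"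
proof (rule coord_eqI)
  note f_closed [simp] = linear_maps_closed[OF f]
  note \<delta>_closed [simp] = abelian_group_hom.hom_closed[OF hom]
  have D: "mat_der \<delta> (\<lambda>i j. coord i (f (u j))) i j \<in> carrier A"
    if "i \<in> {1..n}" "j \<in> {1..n}" for i j
    using that unfolding mat_der_def by simp
  have Dx: "coord_der A F n u \<delta> x \<in> carrier F"
    using x by (simp add: coord_der_closed)
  show "coord_der A F n u \<delta> (f x) \<in> carrier F"
    using x by (simp add: coord_der_closed)
  show "mat_apply A F n u (mat_der \<delta> (\<lambda>i j. coord i (f (u j)))) x \<oplus>\<^bsub>F\<^esub> f (coord_der A F n u \<delta> x)
      \<in> carrier F"
    using x Dx D by (intro M.a_closed mat_apply_closed f_closed)
  fix i assume i: "i \<in> {1..n}"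
  have "coord i (coord_der A F n u \<delta> (f x)) = \<delta> (\<Oplus>j\<in>{1..n}. coord i (f (u j)) \<otimes> coord j x)"
    using x i by (simp add: coord_coord_der flip: coord_linear[OF f])
  also have "\<dots> = (\<Oplus>j\<in>{1..n}. \<delta> (coord i (f (u j)) \<otimes> coord j x))"
    using x i by (intro abelian_group_hom.hom_finsum[OF hom]) auto
  also have "\<dots> = (\<Oplus>j\<in>{1..n}. \<delta> (coord i (f (u j))) \<otimes> coord j x
      \<oplus> coord i (f (u j)) \<otimes> \<delta> (coord j x))"
    using x i
    by (intro R.finsum_cong') (auto simp: product_rule R.a_comm)
  also have "\<dots> = (\<Oplus>j\<in>{1..n}. \<delta> (coord i (f (u j))) \<otimes> coord j x)
      \<oplus> (\<Oplus>j\<in>{1..n}. coord i (f (u j)) \<otimes> \<delta> (coord j x))"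
    using x i by (intro R.finsum_addf) auto
  also have "(\<Oplus>j\<in>{1..n}. \<delta> (coord i (f (u j))) \<otimes> coord j x)
      = coord i (mat_apply A F n u (mat_der \<delta> (\<lambda>i j. coord i (f (u j)))) x)"
    using D x i by (subst coord_mat_apply) (auto simp: mat_der_def)
  also have "(\<Oplus>j\<in>{1..n}. coord i (f (u j)) \<otimes> \<delta> (coord j x)) = coord i (f (coord_der A F n u \<delta> x))"
    unfolding coord_linear[OF f Dx i]
    using x i by (intro R.finsum_cong') (auto simp: coord_coord_der)
  finally show "coord i (coord_der A F n u \<delta> (f x))
      = coord i (mat_apply A F n u (mat_der \<delta> (\<lambda>i j. coord i (f (u j)))) x
        \<oplus>\<^bsub>F\<^esub> f (coord_der A F n u \<delta> x))"
    using D x Dx i by (simp add: coord_add mat_apply_closed)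
qed

end

section \<open>Curvature of a projected connection\<close>

text \<open>
  Only additivity enters here: \<open>P\<close> and \<open>P'\<close> measure the failure of \<open>D\<close> and \<open>D'\<close> to commute with the
  idempotent \<open>s \<circ> p\<close>. Moving \<open>s \<circ> p\<close> past \<open>D'\<close> leaves the obstruction \<open>p (P (s (p (D' x))))\<close>, which
  vanishes because the derivative \<open>P\<close> of an idempotent compresses to zero on its image.
\<close>

lemma project_composite:
  assumes p: "abelian_group_hom F E p"
    and s: "\<And>y. y \<in> carrier E \<Longrightarrow> s y \<in> carrier F"
    and ps: "\<And>y. y \<in> carrier E \<Longrightarrow> p (s y) = y"
    and P: "abelian_group_hom F F P"
    and P': "\<And>z. z \<in> carrier F \<Longrightarrow> P' z \<in> carrier F"
    and D: "\<And>z. z \<in> carrier F \<Longrightarrow> D z \<in> carrier F"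
    and D': "\<And>z. z \<in> carrier F \<Longrightarrow> D' z \<in> carrier F"
    and leibniz: "\<And>z. z \<in> carrier F \<Longrightarrow> D (s (p z)) = P z \<oplus>\<^bsub>F\<^esub> s (p (D z))"
    and leibniz': "\<And>z. z \<in> carrier F \<Longrightarrow> D' (s (p z)) = P' z \<oplus>\<^bsub>F\<^esub> s (p (D' z))"
    and x: "x \<in> carrier F"
  shows "p (D (s (p (D' (s (p x)))))) = p (P (P' x)) \<oplus>\<^bsub>E\<^esub> p (D (D' (s (p x))))"
proof -
  interpret p: abelian_group_hom F E p by (rule p)
  interpret P: abelian_group_hom F F P by (rule P)
  have projected_leibniz: "p (D (s (p z))) = p (P z) \<oplus>\<^bsub>E\<^esub> p (D z)" if "z \<in> carrier F" for z
    using that by (simp add: leibniz D s ps)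
  \<comment> \<open>The projected rule at \<open>s (p z)\<close>, a fixed point of \<open>s \<circ> p\<close>, has the same term on both sides.\<close>
  have P_vanishes: "p (P (s (p z))) = \<zero>\<^bsub>E\<^esub>" if z: "z \<in> carrier F" for z
  proof -
    have "p (D (s (p z))) = p (P (s (p z))) \<oplus>\<^bsub>E\<^esub> p (D (s (p z)))"
      using projected_leibniz[of "s (p z)"] z by (simp add: s ps)
    then show ?thesis
      using z by (simp add: s D)
  qed
  have "p (D (s (p (D' (s (p x)))))) = p (P (D' (s (p x)))) \<oplus>\<^bsub>E\<^esub> p (D (D' (s (p x))))"
    using x by (intro projected_leibniz D' s p.hom_closed)
  also have "p (P (D' (s (p x)))) = p (P (P' x)) \<oplus>\<^bsub>E\<^esub> p (P (s (p (D' x))))"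
    using x by (simp add: leibniz' P' D' s)
  also have "\<dots> = p (P (P' x))"
    using x by (simp add: P_vanishes P' D')
  finally show ?thesis .
qed

theorem corollary2p15:
  fixes k :: "('k, 'q) ring_scheme"
    and A :: "('k, 'a, 'b) module_scheme"
    and F :: "('a, 'f, 'c) module_scheme"
    and E :: "('a, 'e, 'd) module_scheme"
    and n :: nat
    and u :: "nat \<Rightarrow> 'f"
    and p :: "'f \<Rightarrow> 'e"
    and s :: "'e \<Rightarrow> 'f"
    and \<delta> \<eta> :: "'a \<Rightarrow> 'a"
    and e :: 'e
    and x :: 'f
  defines "M \<equiv> fundamental_matrix A F n u p s"
  assumes "algebra k A"
    and "free_basis A F n u"
    and "fg_projective A E"
    and "p \<in> linear_maps A F E" and "p ` carrier F = carrier E"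
    and "s \<in> linear_maps A E F" and "\<And>y. y \<in> carrier E \<Longrightarrow> p (s y) = y"
    and "\<delta> \<in> derivations k A" and "\<eta> \<in> derivations k A"
    and "e \<in> carrier E" and "x \<in> carrier F" and "p x = e"
  shows "curvature A E (induced_connection A F n u p s) \<delta> \<eta> e =
    p (mat_apply A F n u (mat_commutator A n (mat_der \<delta> M) (mat_der \<eta> M)) x)"
proof -
  note p = \<open>p \<in> linear_maps A F E\<close> and s = \<open>s \<in> linear_maps A E F\<close>
  note \<delta> = \<open>\<delta> \<in> derivations k A\<close> and \<eta> = \<open>\<eta> \<in> derivations k A\<close>
  note x = \<open>x \<in> carrier F\<close> and e = \<open>p x = e\<close>
  note ps = \<open>\<And>y. y \<in> carrier E \<Longrightarrow> p (s y) = y\<close>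
  interpret framed_module A F n u
    using assms(3) by (auto simp: free_basis_def framed_module_def framed_module_axioms_def)
  interpret E: module A E
    using assms(4) by (simp add: fg_projective_def)
  interpret p: abelian_group_hom F E p
    using p by (intro abelian_group_hom_of_linear M.abelian_group_axioms E.abelian_group_axioms)
  note s_closed [simp] = linear_maps_closed[OF s]
  note \<delta>_closed [simp] = linear_maps_closed[OF derivations_linear[OF \<delta>]]
  note \<eta>_closed [simp] = linear_maps_closed[OF derivations_linear[OF \<eta>]]
  let ?D = "coord_der A F n u"
  let ?P = "\<lambda>\<theta>. mat_apply A F n u (mat_der \<theta> M)"
  have \<phi>: "(\<lambda>z. s (p z)) \<in> linear_maps A F F"
    using linear_mapsD[OF p] linear_mapsD[OF s] by (simp add: linear_maps_def)
  have M: "M = (\<lambda>i j. coord i (s (p (u j))))"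
    by (simp add: M_def fundamental_matrix_def)
  have entry: "mat_der \<theta> M i j \<in> carrier A"
    if "\<theta> \<in> derivations k A" "i \<in> {1..n}" "j \<in> {1..n}" for \<theta> i j
    using that by (simp add: M mat_der_def linear_maps_closed[OF derivations_linear])
  have D_closed: "?D \<theta> z \<in> carrier F" if "\<theta> \<in> derivations k A" "z \<in> carrier F" for \<theta> z
    using that by (simp add: coord_der_closed linear_maps_closed[OF derivations_linear])
  have P_hom: "abelian_group_hom F F (?P \<theta>)" if "\<theta> \<in> derivations k A" for \<theta>
    using entry[OF that] by (rule mat_apply_hom)
  have P_closed: "?P \<theta> z \<in> carrier F" if "\<theta> \<in> derivations k A" "z \<in> carrier F" for \<theta> z
    using entry[OF that(1)] that(2) by (rule mat_apply_closed)
  have leibniz: "?D \<theta> (s (p z)) = ?P \<theta> z \<oplus>\<^bsub>F\<^esub> s (p (?D \<theta> z))"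
    if "\<theta> \<in> derivations k A" "z \<in> carrier F" for \<theta> z
    using coord_der_linear[OF \<phi> _ derivations_leibniz[OF that(1)] that(2)]
      abelian_group_hom_of_linear[OF R.abelian_group_axioms R.abelian_group_axioms
        derivations_linear[OF that(1)]]
    by (simp add: M)
  have composite: "p (?D \<theta> (s (p (?D \<zeta> (s (p x))))))
      = p (?P \<theta> (?P \<zeta> x)) \<oplus>\<^bsub>E\<^esub> p (?D \<theta> (?D \<zeta> (s (p x))))"
    if "\<theta> \<in> derivations k A" "\<zeta> \<in> derivations k A" for \<theta> \<zeta>
    using p.abelian_group_hom_axioms s_closed ps P_hom[OF that(1)] P_closed[OF that(2)]
      D_closed[OF that(1)] D_closed[OF that(2)] leibniz[OF that(1)] leibniz[OF that(2)] x
    by (rule project_composite)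
  have sx: "s (p x) \<in> carrier F"
    using x by simp
  have conn: "induced_connection A F n u p s \<theta> y = p (?D \<theta> (s y))" if "y \<in> carrier E" for \<theta> y
    using that by (simp add: induced_connection_def nabla_def ps)
  have pc: "p (?D \<theta> z) \<in> carrier E" if "\<theta> \<in> derivations k A" "z \<in> carrier F" for \<theta> z
    using D_closed[OF that] by simp
  note closed = D_closed[OF \<delta>] D_closed[OF \<eta>] P_closed[OF \<delta>] P_closed[OF \<eta>]
  let ?a = "p (?P \<delta> (?P \<eta> x))" and ?b = "p (?P \<eta> (?P \<delta> x))"
  let ?c = "p (?D \<delta> (?D \<eta> (s (p x))))" and ?d = "p (?D \<eta> (?D \<delta> (s (p x))))"
  have "curvature A E (induced_connection A F n u p s) \<delta> \<eta> e
      = (p (?D \<delta> (s (p (?D \<eta> (s (p x)))))) \<ominus>\<^bsub>E\<^esub> p (?D \<eta> (s (p (?D \<delta> (s (p x)))))))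
        \<ominus>\<^bsub>E\<^esub> p (?D (der_bracket A \<delta> \<eta>) (s (p x)))"
    using x sx pc[OF \<delta>] pc[OF \<eta>] by (simp add: curvature_def conn flip: e)
  also have "\<dots> = ((?a \<oplus>\<^bsub>E\<^esub> ?c) \<ominus>\<^bsub>E\<^esub> (?b \<oplus>\<^bsub>E\<^esub> ?d)) \<ominus>\<^bsub>E\<^esub> (?c \<ominus>\<^bsub>E\<^esub> ?d)"
    using sx closed by (simp add: composite \<delta> \<eta> coord_der_bracket p.hom_minus)
  also have "\<dots> = ?a \<ominus>\<^bsub>E\<^esub> ?b"
    using x sx by (intro E.M.sum_difference_cancel p.hom_closed closed)
  also have "\<dots> = p (mat_apply A F n u (mat_commutator A n (mat_der \<delta> M) (mat_der \<eta> M)) x)"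
    using x closed entry[OF \<delta>] entry[OF \<eta>] by (simp add: mat_commutator_apply p.hom_minus)
  finally show ?thesis .
qed

end
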